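(* Let $m,l\ge 2$ be integers. Then $\chi_{=}(K_1\circ^l P_m)=3$ if $m\in\{2,3,4,5\}$; $\chi_{=}(K_1\circ^l P_m)=4$ if $m\ge 6$ and $m$ is even; and $\chi_{=}(K_1\circ^l P_m)\le 4$ otherwise.
   Context: All graphs are finite, simple and connected. $K_1$ is the single-vertex graph and $P_m$ the path on $m$ vertices. A graph is equitably $k$-colorable if its vertex set can be partitioned into $k$ (possibly empty) independent sets $V_1,\dots,V_k$ with $||V_i|-|V_j||\le 1$ for all $i,j$; $\chi_{=}(G)$ is the least $k$ for which $G$ is equitably $k$-colorable. The corona $G\circ H$ is formed from one copy of $G$ and $|V(G)|$ copies of $H$, the $i$-th vertex of $G$ being joined to every vertex of the $i$-th copy of $H$; $G\circ^1 H=G\circ H$ and $G\circ^l H=(G\circ^{l-1}H)\circ H$ for $l\ge 2$. *)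

theory Defs
  imports "Graph_Theory.Pair_Digraph" "HOL-Library.Disjoint_Sets"
begin

text \<open>
  Finite simple graphs are values of type \<^typ>\<open>'a pair_pre_digraph\<close> satisfying
  \<^const>\<open>pair_graph\<close>: an undirected edge is represented by its two opposite arcs.
\<close>

definition K1 :: "unit pair_pre_digraph" where
  "K1 = \<lparr> pverts = {()}, parcs = {} \<rparr>"

definition path_graph :: "nat \<Rightarrow> nat pair_pre_digraph" where
  "path_graph m = \<lparr> pverts = {..<m},
     parcs = {(i, j). i < m \<and> j < m \<and> (j = Suc i \<or> i = Suc j)} \<rparr>"

definition independent_set :: "'a pair_pre_digraph \<Rightarrow> 'a set \<Rightarrow> bool" where
  "independent_set G S \<longleftrightarrow> S \<subseteq> pverts G \<and> (\<forall>u\<in>S. \<forall>v\<in>S. (u, v) \<notin> parcs G)"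

definition equitably_colorable :: "'a pair_pre_digraph \<Rightarrow> nat \<Rightarrow> bool" where
  "equitably_colorable G k \<longleftrightarrow> (\<exists>V :: nat \<Rightarrow> 'a set.
     disjoint_family_on V {..<k} \<and> (\<Union>i<k. V i) = pverts G \<and>
     (\<forall>i<k. independent_set G (V i)) \<and>
     (\<forall>i<k. \<forall>j<k. \<bar>int (card (V i)) - int (card (V j))\<bar> \<le> 1))"

definition equitable_chromatic_number :: "'a pair_pre_digraph \<Rightarrow> nat" (\<open>\<chi>\<^sub>=\<close>) where
  "\<chi>\<^sub>= G = (LEAST k. equitably_colorable G k)"

text \<open>
  In the corona, \<open>(v, None)\<close> is the vertex \<open>v\<close> of the copy of \<open>G\<close>, and \<open>(v, Some x)\<close>
  is the vertex \<open>x\<close> of the copy of \<open>H\<close> belonging to \<open>v\<close>.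
\<close>

definition corona :: "'a pair_pre_digraph \<Rightarrow> 'b pair_pre_digraph \<Rightarrow> ('a \<times> 'b option) pair_pre_digraph" where
  "corona G H = \<lparr>
     pverts = {(v, None) | v. v \<in> pverts G} \<union>
              {(v, Some x) | v x. v \<in> pverts G \<and> x \<in> pverts H},
     parcs = {((u, None), (v, None)) | u v. (u, v) \<in> parcs G} \<union>
             {((v, Some x), (v, Some y)) | v x y. v \<in> pverts G \<and> (x, y) \<in> parcs H} \<union>
             {((v, None), (v, Some x)) | v x. v \<in> pverts G \<and> x \<in> pverts H} \<union>
             {((v, Some x), (v, None)) | v x. v \<in> pverts G \<and> x \<in> pverts H} \<rparr>"

definition relabel :: "('a \<Rightarrow> 'b) \<Rightarrow> 'a pair_pre_digraph \<Rightarrow> 'b pair_pre_digraph" where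
  "relabel f G = \<lparr> pverts = f ` pverts G, parcs = map_prod f f ` parcs G \<rparr>"

text \<open>
  Each corona changes the vertex type, so to iterate it the vertices are renamed injectively
  into the fixed type \<^typ>\<open>'a \<times> 'b option list\<close>, whose list records the second component
  contributed by each corona, the latest first. The case \<open>0\<close> is a copy of \<open>G\<close>.
\<close>

primrec corona_power :: "'a pair_pre_digraph \<Rightarrow> 'b pair_pre_digraph \<Rightarrow> nat \<Rightarrow> ('a \<times> 'b option list) pair_pre_digraph" where
  "corona_power G H 0 = relabel (\<lambda>v. (v, [])) G"
| "corona_power G H (Suc l) =
     relabel (\<lambda>((v, xs), x). (v, x # xs)) (corona (corona_power G H l) H)"

lemma pverts_corona: "pverts (corona G H) = pverts G \<times> insert None (Some ` pverts H)"
  by (auto simp: corona_def)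

lemma corona_relabel: "corona (relabel f G) H = relabel (map_prod f id) (corona G H)"
proof -
  have "pverts (corona (relabel f G) H) = pverts (relabel (map_prod f id) (corona G H))"
    by (simp add: pverts_corona relabel_def map_prod_surj_on[where g = id, OF refl refl])
  moreover have "parcs (corona (relabel f G) H) = parcs (relabel (map_prod f id) (corona G H))"
    (is "?L = ?R")
  proof
    show "?R \<subseteq> ?L"
      by (auto simp: corona_def relabel_def)
    show "?L \<subseteq> ?R"
    proof
      fix e assume "e \<in> ?L"
      then consider
          u v where "e = ((f u, None), (f v, None))" "(u, v) \<in> parcs G"
        | v x y where "e = ((f v, Some x), (f v, Some y))" "v \<in> pverts G" "(x, y) \<in> parcs H"
        | v x where "e = ((f v, None), (f v, Some x))" "v \<in> pverts G" "x \<in> pverts H"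
        | v x where "e = ((f v, Some x), (f v, None))" "v \<in> pverts G" "x \<in> pverts H"
        by (auto simp: corona_def relabel_def)
      then show "e \<in> ?R"
      proof cases
        case (1 u v)
        then show ?thesis unfolding relabel_def corona_def
          by (auto intro!: rev_image_eqI[of "((u, None), (v, None))"])
      next
        case (2 v x y)
        then show ?thesis unfolding relabel_def corona_def
          by (auto intro!: rev_image_eqI[of "((v, Some x), (v, Some y))"])
      next
        case (3 v x)
        then show ?thesis unfolding relabel_def corona_def
          by (auto intro!: rev_image_eqI[of "((v, None), (v, Some x))"])
      next
        case (4 v x)
        then show ?thesis unfolding relabel_def corona_def
          by (auto intro!: rev_image_eqI[of "((v, Some x), (v, None))"])
      qed
    qed
  qed
  ultimately show ?thesis by simp
qed

lemma corona_power_1: "corona_power G H 1 = relabel (\<lambda>(v, x). (v, [x])) (corona G H)"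
proof -
  have 2: "relabel f (relabel g K) = relabel (f \<circ> g) K"
    for f :: "'d \<Rightarrow> 'e" and g :: "'c \<Rightarrow> 'd" and K
    by (simp add: relabel_def image_comp map_prod.comp)
  show ?thesis
    by (simp add: corona_relabel 2) (rule arg_cong[where f = "\<lambda>f. relabel f (corona G H)"], auto)
qed

lemma pair_graph_K1: "pair_graph K1"
  by unfold_locales (auto simp: K1_def symmetric_def sym_def)

lemma pair_graph_path_graph: "pair_graph (path_graph m)"
proof -
  have "finite (parcs (path_graph m))"
    by (rule finite_subset[of _ "{..<m} \<times> {..<m}"]) (auto simp: path_graph_def)
  then show ?thesis
    by unfold_locales (auto simp: path_graph_def symmetric_def sym_def)
qed

lemma pair_graph_corona:
  assumes "pair_graph G" "pair_graph H"
  shows "pair_graph (corona G H)"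
proof -
  interpret G: pair_graph G by fact
  interpret H: pair_graph H by fact
  have V: "finite (pverts (corona G H))"
    by (rule finite_subset[of _ "pverts G \<times> (insert None (Some ` pverts H))"])
      (auto simp: corona_def G.pair_finite_verts H.pair_finite_verts)
  have A: "parcs (corona G H) \<subseteq> pverts (corona G H) \<times> pverts (corona G H)"
    by (auto simp: corona_def dest: G.in_arcsD1 G.in_arcsD2 H.in_arcsD1 H.in_arcsD2)
  have "finite (parcs (corona G H))"
    using A V by (meson finite_SigmaI finite_subset)
  moreover have "sym (parcs (corona G H))"
    by (rule symI) (auto simp: corona_def dest: G.arcs_symmetric H.arcs_symmetric)
  moreover have "fst e \<noteq> snd e" if "e \<in> parcs (corona G H)" for e
    using that by (auto simp: corona_def dest: G.no_loops' H.no_loops')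
  ultimately show ?thesis
    using V A by unfold_locales (auto simp: symmetric_def)
qed

lemma pair_graph_relabel:
  assumes "pair_graph G" "inj f"
  shows "pair_graph (relabel f G)"
proof -
  interpret G: pair_graph G by fact
  show ?thesis
    using \<open>inj f\<close>
    by unfold_locales
      (auto simp: relabel_def symmetric_def inj_eq G.pair_finite_verts G.pair_finite_arcs
        intro!: symI dest: G.in_arcsD1 G.in_arcsD2 G.no_loops' G.arcs_symmetric)
qed

lemma pair_graph_corona_power:
  assumes "pair_graph G" "pair_graph H"
  shows "pair_graph (corona_power G H l)"
proof (induction l)
  case 0
  show ?case using assms(1) by (auto intro!: pair_graph_relabel injI)
next
  case (Suc l)
  then show ?case
    using assms(2) by (auto intro!: pair_graph_relabel pair_graph_corona injI)
qed

lemma ex_equitably_colorable: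
  assumes "pair_graph G"
  shows "equitably_colorable G (card (pverts G))"
proof -
  interpret G: pair_graph G by fact
  obtain f where f: "bij_betw f {..<card (pverts G)} (pverts G)"
    using ex_bij_betw_nat_finite[OF G.pair_finite_verts] by (auto simp: lessThan_atLeast0)
  have "f ` {..<card (pverts G)} = pverts G"
    using f by (rule bij_betw_imp_surj_on)
  moreover have "disjoint_family_on (\<lambda>i. {f i}) {..<card (pverts G)}"
    using f by (auto simp: disjoint_family_on_def bij_betw_def dest: inj_onD)
  ultimately show ?thesis
    unfolding equitably_colorable_def independent_set_def
    by (intro exI[of _ "\<lambda>i. {f i}"]) (auto dest: G.no_loops')
qed

end

theory Submission
  imports Defs
begin

text \<open>
  Only the multiset of colours of a proper colouring matters: a colouring of a corona is a
  colouring of the base graph together with, for each base vertex \<open>v\<close>, a colouring of \<open>H\<close> that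
  avoids the colour of \<open>v\<close>.

  For \<open>m = 2 h\<close> a 3-colouring is forced to use each of the two colours other than that of \<open>v\<close>
  exactly \<open>h\<close> times on the path of \<open>v\<close>. Passing to the corona therefore multiplies the
  differences of class sizes by \<open>1 - h\<close>, so for \<open>h \<ge> 3\<close> they are at least \<open>2 ^ l\<close> after \<open>l\<close> steps.

  For the colourings, a set of base vertices in which all colours are equally frequent stays
  balanced when the paths are coloured cyclically. So only the few surplus vertices have to be
  treated, in the 4-colour case with one balanced quadruple if a single vertex is in surplus.
  With four colours the root colour occurs only once for \<open>l = 1\<close>, and that colouring is not
  equitable for large \<open>m\<close>; the induction therefore starts from an explicit colouring for \<open>l = 2\<close>.
\<close>

section \<open>Colour multisets and their behaviour under coronas\<close>

definition colorable_with :: "'a pair_pre_digraph \<Rightarrow> nat multiset \<Rightarrow> bool" where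
  "colorable_with G M \<longleftrightarrow> (\<exists>f. (\<forall>u v. (u, v) \<in> parcs G \<longrightarrow> f u \<noteq> f v) \<and>
     image_mset f (mset_set (pverts G)) = M)"

text \<open>
  \<open>corona_ext H M M'\<close>: a colouring of a graph with colour multiset \<open>M\<close> extends to one of its
  corona with \<open>H\<close> that has colour multiset \<open>M'\<close>.
\<close>

inductive corona_ext :: "'b pair_pre_digraph \<Rightarrow> nat multiset \<Rightarrow> nat multiset \<Rightarrow> bool"
  for H where
  empty: "corona_ext H {#} {#}"
| add: "corona_ext H A B \<Longrightarrow> colorable_with H P \<Longrightarrow> c \<notin># P \<Longrightarrow>
    corona_ext H (add_mset c A) (add_mset c P + B)"

lemma corona_ext_union:
  assumes "corona_ext H A A'" "corona_ext H B B'"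
  shows "corona_ext H (A + B) (A' + B')"
  using assms(1)
proof induction
  case empty
  then show ?case using assms(2) by simp
next
  case (add A A' P c)
  from corona_ext.add[OF add.IH add.hyps(2,3)] show ?case by (simp add: add.assoc)
qed

lemma corona_ext_repeat:
  assumes "corona_ext H A A'"
  shows "corona_ext H (repeat_mset n A) (repeat_mset n A')"
proof (induction n)
  case 0
  then show ?case by (simp add: corona_ext.empty)
next
  case (Suc n)
  then show ?case using corona_ext_union[OF assms Suc] by simp
qed

lemma image_mset_set_times:
  assumes "finite A" "finite B"
  shows "image_mset F (mset_set (A \<times> B)) =
    (\<Sum>a\<in>A. image_mset (\<lambda>b. F (a, b)) (mset_set B))"
  using assms(1)
proof induction
  case empty
  then show ?case by simp
next
  case (insert a A)
  have eq: "insert a A \<times> B = Pair a ` B \<union> A \<times> B" by auto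
  have "mset_set (Pair a ` B \<union> A \<times> B) = mset_set (Pair a ` B) + mset_set (A \<times> B)"
    using insert assms by (intro mset_set_Union) auto
  moreover have "mset_set (Pair a ` B) = image_mset (Pair a) (mset_set B)"
    by (rule image_mset_mset_set[symmetric]) (auto simp: inj_on_def)
  ultimately show ?case
    using insert unfolding eq by (simp add: multiset.map_comp o_def)
qed

lemma image_mset_corona:
  assumes "finite (pverts G)" "finite (pverts H)"
  shows "image_mset f (mset_set (pverts (corona G H))) = (\<Sum>v\<in>pverts G.
    add_mset (f (v, None)) (image_mset (\<lambda>x. f (v, Some x)) (mset_set (pverts H))))"
proof -
  have "mset_set (Some ` pverts H) = image_mset Some (mset_set (pverts H))"
    by (rule image_mset_mset_set[symmetric]) auto
  then have "mset_set (insert None (Some ` pverts H)) =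
      add_mset None (image_mset Some (mset_set (pverts H)))"
    using assms(2) by (subst mset_set.insert) auto
  then show ?thesis
    using assms by (simp add: pverts_corona image_mset_set_times multiset.map_comp o_def)
qed

lemma corona_ext_sum:
  assumes "finite S" "\<And>v. v \<in> S \<Longrightarrow> colorable_with H (P v) \<and> f v \<notin># P v"
  shows "corona_ext H (image_mset f (mset_set S)) (\<Sum>v\<in>S. add_mset (f v) (P v))"
  using assms
proof (induction S)
  case empty
  then show ?case by (simp add: corona_ext.empty)
next
  case (insert v S)
  then show ?case
    using corona_ext.add[of H _ _ "P v" "f v"] by simp
qed

text \<open>Converse of \<open>corona_ext_sum\<close>. Each use of the rule \<open>add\<close>
  consumes one occurrence of a colour \<open>c\<close>; any vertex of \<open>S\<close> with that
  colour can take the block \<open>Q\<close>, and the induction continues on \<open>S - {v}\<close>.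
  Hence the blocks fit every \<open>f\<close> with colour multiset \<open>M\<close>.\<close>

lemma corona_ext_obtain:
  assumes "corona_ext H M M'" "finite S" "image_mset f (mset_set S) = M"
  shows "\<exists>P. (\<forall>v\<in>S. colorable_with H (P v) \<and> f v \<notin># P v) \<and>
    M' = (\<Sum>v\<in>S. add_mset (f v) (P v))"
  using assms
proof (induction arbitrary: S)
  case empty
  then show ?case by (auto simp: mset_set_empty_iff)
next
  case (add A B Q c)
  have "c \<in># image_mset f (mset_set S)" using add.prems by simp
  then obtain v where v: "v \<in> S" "f v = c"
    using add.prems(1) unfolding set_image_mset by auto
  have "mset_set S = add_mset v (mset_set (S - {v}))"
    using v add.prems by (simp add: mset_set.remove)
  then have "image_mset f (mset_set (S - {v})) = A"
    using add.prems v by simp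
  with add.IH[of "S - {v}"] add.prems(1) obtain P where
    P: "\<forall>w\<in>S - {v}. colorable_with H (P w) \<and> f w \<notin># P w"
       "B = (\<Sum>w\<in>S - {v}. add_mset (f w) (P w))" by auto
  have "(\<Sum>w\<in>S. add_mset (f w) ((P(v := Q)) w)) =
      add_mset c Q + (\<Sum>w\<in>S - {v}. add_mset (f w) ((P(v := Q)) w))"
    using v add.prems by (simp add: sum.remove)
  also have "(\<Sum>w\<in>S - {v}. add_mset (f w) ((P(v := Q)) w)) = B"
    unfolding P(2) by (rule sum.cong) auto
  finally show ?case
    using P(1) add.hyps v by (intro exI[of _ "P(v := Q)"]) auto
qed

text \<open>Left to right, the colouring is restricted to the base and to each copy of
  \<open>H\<close>. Right to left, \<open>corona_ext_obtain\<close> distributes the blocks over the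
  base vertices and \<open>F\<close> glues the pieces. As the base enters only through its colour
  multiset, coronas can be iterated on multisets alone.\<close>

lemma colorable_with_corona_iff:
  assumes "pair_graph G" "pair_graph H"
  shows "colorable_with (corona G H) M' \<longleftrightarrow> (\<exists>M. colorable_with G M \<and> corona_ext H M M')"
proof -
  interpret G: pair_graph G by fact
  interpret H: pair_graph H by fact
  note fin = G.pair_finite_verts H.pair_finite_verts
  show ?thesis
  proof
    assume "colorable_with (corona G H) M'"
    then obtain f where
      f: "\<And>u v. (u, v) \<in> parcs (corona G H) \<Longrightarrow> f u \<noteq> f v"
         "image_mset f (mset_set (pverts (corona G H))) = M'"
      unfolding colorable_with_def by blast
    define g where "g v = f (v, None)" for v
    define P where "P v = image_mset (\<lambda>x. f (v, Some x)) (mset_set (pverts H))" for v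
    have "colorable_with G (image_mset g (mset_set (pverts G)))"
      unfolding colorable_with_def
      by (rule exI[of _ g]) (auto simp: g_def corona_def intro!: f(1))
    moreover have "colorable_with H (P v) \<and> g v \<notin># P v" if v: "v \<in> pverts G" for v
    proof
      show "colorable_with H (P v)"
        unfolding colorable_with_def P_def
        using v by (intro exI[of _ "\<lambda>x. f (v, Some x)"]) (auto simp: corona_def intro!: f(1))
      have "f (v, None) \<noteq> f (v, Some x)" if "x \<in> pverts H" for x
        using v that by (intro f(1)) (auto simp: corona_def)
      then show "g v \<notin># P v" using fin by (auto simp: P_def g_def)
    qed
    ultimately show "\<exists>M. colorable_with G M \<and> corona_ext H M M'"
      using corona_ext_sum[OF fin(1), of H P g] f(2) image_mset_corona[OF fin, of f]
      by (auto simp: g_def P_def)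
  next
    assume "\<exists>M. colorable_with G M \<and> corona_ext H M M'"
    then obtain M f where f: "\<And>u v. (u, v) \<in> parcs G \<Longrightarrow> f u \<noteq> f v"
      "image_mset f (mset_set (pverts G)) = M" "corona_ext H M M'"
      unfolding colorable_with_def by blast
    from corona_ext_obtain[OF f(3) fin(1) f(2)] obtain P where
      P: "\<And>v. v \<in> pverts G \<Longrightarrow> colorable_with H (P v)"
         "\<And>v. v \<in> pverts G \<Longrightarrow> f v \<notin># P v"
         "M' = (\<Sum>v\<in>pverts G. add_mset (f v) (P v))" by blast
    from P(1) have "\<forall>v. \<exists>g. v \<in> pverts G \<longrightarrow> (\<forall>x y. (x, y) \<in> parcs H \<longrightarrow> g x \<noteq> g y) \<and>
        image_mset g (mset_set (pverts H)) = P v"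
      unfolding colorable_with_def by blast
    then obtain g where
      g: "\<And>v x y. v \<in> pverts G \<Longrightarrow> (x, y) \<in> parcs H \<Longrightarrow> g v x \<noteq> g v y"
         "\<And>v. v \<in> pverts G \<Longrightarrow> image_mset (g v) (mset_set (pverts H)) = P v"
      by metis
    define F where "F = (\<lambda>(v, z). case z of None \<Rightarrow> f v | Some x \<Rightarrow> g v x)"
    have ne: "f v \<noteq> g v x" if "v \<in> pverts G" "x \<in> pverts H" for v x
      using P(2)[OF that(1)] that(2) fin unfolding g(2)[OF that(1), symmetric] by auto
    have "F u \<noteq> F v" if "(u, v) \<in> parcs (corona G H)" for u v
      using that f(1) g(1) ne ne[symmetric] by (auto simp: corona_def F_def)
    moreover have "image_mset F (mset_set (pverts (corona G H))) = M'"
      unfolding image_mset_corona[OF fin] P(3) by (rule sum.cong) (auto simp: F_def g(2))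
    ultimately show "colorable_with (corona G H) M'"
      unfolding colorable_with_def by blast
  qed
qed

lemma colorable_with_relabel:
  assumes "inj f"
  shows "colorable_with (relabel f G) M \<longleftrightarrow> colorable_with G M"
proof -
  have ms: "mset_set (f ` pverts G) = image_mset f (mset_set (pverts G))"
    using assms by (intro image_mset_mset_set[symmetric]) (auto simp: inj_on_def)
  show ?thesis
  proof
    assume "colorable_with (relabel f G) M"
    then obtain g where g: "\<And>u v. (u, v) \<in> parcs (relabel f G) \<Longrightarrow> g u \<noteq> g v"
       "image_mset g (mset_set (f ` pverts G)) = M"
      unfolding colorable_with_def by (auto simp: relabel_def)
    have "g (f u) \<noteq> g (f v)" if "(u, v) \<in> parcs G" for u v
      using that by (intro g(1)) (force simp: relabel_def)
    then show "colorable_with G M"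
      using g(2) unfolding colorable_with_def ms
      by (intro exI[of _ "g \<circ> f"]) (auto simp: multiset.map_comp)
  next
    assume "colorable_with G M"
    then obtain g where "\<And>u v. (u, v) \<in> parcs G \<Longrightarrow> g u \<noteq> g v"
       "image_mset g (mset_set (pverts G)) = M"
      unfolding colorable_with_def by auto
    then show "colorable_with (relabel f G) M"
      using assms unfolding colorable_with_def
      by (intro exI[of _ "g \<circ> inv f"]) (auto simp: relabel_def ms multiset.map_comp o_def)
  qed
qed

lemma colorable_with_corona_power_Suc:
  assumes "pair_graph G" "pair_graph H"
  shows "colorable_with (corona_power G H (Suc l)) M' \<longleftrightarrow>
    (\<exists>M. colorable_with (corona_power G H l) M \<and> corona_ext H M M')"
  unfolding corona_power.simps
  by (subst colorable_with_relabel)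
    (auto simp: inj_def colorable_with_corona_iff[OF pair_graph_corona_power[OF assms] assms(2)])

lemma colorable_with_K1_power_0:
  "colorable_with (corona_power K1 H 0) M \<longleftrightarrow> (\<exists>c. M = {#c#})"
  unfolding corona_power.simps
  by (subst colorable_with_relabel) (auto simp: inj_def colorable_with_def K1_def)

text \<open>The classes are the fibres of a colouring by numbers below \<open>k\<close>, and their
  sizes are the counts in \<open>M\<close>. A colour below \<open>k\<close> that is missing from
  \<open>M\<close> stands for an empty class.\<close>

lemma equitably_colorable_iff:
  assumes "pair_graph G"
  shows "equitably_colorable G k \<longleftrightarrow> (\<exists>M. colorable_with G M \<and> set_mset M \<subseteq> {..<k} \<and>
    (\<forall>i<k. \<forall>j<k. \<bar>int (count M i) - int (count M j)\<bar> \<le> 1))"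
proof -
  interpret G: pair_graph G by fact
  note fin = G.pair_finite_verts
  have cnt: "count (image_mset f (mset_set (pverts G))) i = card {v \<in> pverts G. f v = i}"
    for f :: "'a \<Rightarrow> nat" and i
    using fin by (simp add: count_image_mset Int_def conj_commute)
  show ?thesis
  proof
    assume "equitably_colorable G k"
    then obtain V where V: "disjoint_family_on V {..<k}" "(\<Union>i<k. V i) = pverts G"
      "\<And>i. i < k \<Longrightarrow> independent_set G (V i)"
      "\<And>i j. i < k \<Longrightarrow> j < k \<Longrightarrow> \<bar>int (card (V i)) - int (card (V j))\<bar> \<le> 1"
      unfolding equitably_colorable_def by blast
    then have "\<forall>v. \<exists>i. v \<in> pverts G \<longrightarrow> i < k \<and> v \<in> V i" by blast
    then obtain f where f: "\<And>v. v \<in> pverts G \<Longrightarrow> f v < k \<and> v \<in> V (f v)" by metis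
    \<comment> \<open>Disjointness of the classes gives equality here, so that counts become class
      cardinalities.\<close>
    have "{v \<in> pverts G. f v = i} = V i" if "i < k" for i
    proof
      show "{v \<in> pverts G. f v = i} \<subseteq> V i" using f by auto
      show "V i \<subseteq> {v \<in> pverts G. f v = i}"
      proof
        fix v assume "v \<in> V i"
        moreover from this have v: "v \<in> pverts G" using V(2) that by blast
        ultimately have "f v = i"
          using f[OF v] V(1) that unfolding disjoint_family_on_def by blast
        then show "v \<in> {v \<in> pverts G. f v = i}" using v by simp
      qed
    qed
    moreover have "f u \<noteq> f v" if "(u, v) \<in> parcs G" for u v
    proof
      assume eq: "f u = f v"
      have "u \<in> pverts G" "v \<in> pverts G" using that by (auto dest: G.in_arcsD1 G.in_arcsD2)
      then show False
        using f[of u] f[of v] V(3)[of "f v"] that eq by (auto simp: independent_set_def)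
    qed
    ultimately show "\<exists>M. colorable_with G M \<and> set_mset M \<subseteq> {..<k} \<and>
        (\<forall>i<k. \<forall>j<k. \<bar>int (count M i) - int (count M j)\<bar> \<le> 1)"
      using V(4) f fin
      by (intro exI[of _ "image_mset f (mset_set (pverts G))"])
        (auto simp: colorable_with_def cnt)
  next
    assume "\<exists>M. colorable_with G M \<and> set_mset M \<subseteq> {..<k} \<and>
        (\<forall>i<k. \<forall>j<k. \<bar>int (count M i) - int (count M j)\<bar> \<le> 1)"
    then obtain M f where f: "\<forall>u v. (u, v) \<in> parcs G \<longrightarrow> f u \<noteq> f v"
      "image_mset f (mset_set (pverts G)) = M" "set_mset M \<subseteq> {..<k}"
      "\<forall>i<k. \<forall>j<k. \<bar>int (count M i) - int (count M j)\<bar> \<le> 1"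
      unfolding colorable_with_def by blast
    have "f v < k" if "v \<in> pverts G" for v
      using f(3) that fin unfolding f(2)[symmetric] by auto
    then show "equitably_colorable G k"
      using f(1,4) unfolding equitably_colorable_def independent_set_def f(2)[symmetric] cnt
      by (intro exI[of _ "\<lambda>i. {v \<in> pverts G. f v = i}"])
        (force simp: disjoint_family_on_def)
  qed
qed

section \<open>Colourings of a single path\<close>

lemma image_mset_alternating:
  assumes "k \<le> m div 2"
  shows "image_mset (\<lambda>j. if even j then x else if j < 2 * k then y else z) (mset_set {..<m}) =
    replicate_mset ((m + 1) div 2) x + replicate_mset k y + replicate_mset (m div 2 - k) z"
    (is "image_mset ?f _ = _")
proof -
  \<comment> \<open>Stated with \<open>min\<close> for every length, because
    \<open>k \<le> m div 2\<close> fails on short initial segments and would not survive the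
    induction.\<close>
  have "image_mset ?f (mset_set {..<m}) = replicate_mset ((m + 1) div 2) x +
      replicate_mset (min k (m div 2)) y + replicate_mset (m div 2 - k) z" for m
  proof (induction m)
    case 0
    then show ?case by simp
  next
    case (Suc m)
    have step: "image_mset ?f (mset_set {..<Suc m}) = add_mset (?f m)
        (replicate_mset ((m + 1) div 2) x + replicate_mset (min k (m div 2)) y +
         replicate_mset (m div 2 - k) z)"
      unfolding Suc.IH[symmetric] by (simp add: lessThan_Suc)
    show ?case
    proof (cases "even m")
      case True
      then show ?thesis unfolding step by (auto elim!: evenE)
    next
      case False
      then obtain t where t: "m = 2 * t + 1" by (auto elim!: oddE)
      then show ?thesis
        unfolding step by (cases "t < k") (auto simp: Suc_diff_le min_absorb1 min_absorb2)
    qed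
  qed
  from this[of m] show ?thesis using assms by (simp add: min_def)
qed

text \<open>Neighbours have opposite parity, so \<open>x\<close> on the even positions never meets
  itself, nor do \<open>y\<close> and \<open>z\<close> on the odd ones. The split of the odd
  positions between \<open>y\<close> and \<open>z\<close> is free, which later serves to tune class
  sizes; \<open>z = y\<close> with \<open>j = 0\<close> gives two-coloured paths.\<close>

lemma colorable_with_path:
  assumes "x \<noteq> y" "x \<noteq> z" "a = (m + 1) div 2" "k + j = m div 2"
  shows "colorable_with (path_graph m) (replicate_mset a x + replicate_mset k y + replicate_mset j z)"
proof -
  have "j = m div 2 - k" "k \<le> m div 2" using assms(4) by auto
  then show ?thesis
    using assms(1,2,3) image_mset_alternating[of k m x y z] unfolding colorable_with_def
    by (intro exI[of _ "\<lambda>j. if even j then x else if j < 2 * k then y else z"])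
      (auto simp: path_graph_def)
qed

lemma corona_ext_path:
  assumes "x \<noteq> y" "x \<noteq> z" "c \<noteq> x" "c \<noteq> y" "c \<noteq> z" "a = (m + 1) div 2" "k + j = m div 2"
  shows "corona_ext (path_graph m) {#c#}
    (add_mset c (replicate_mset a x + replicate_mset k y + replicate_mset j z))"
  using corona_ext.add[OF corona_ext.empty colorable_with_path[OF assms(1,2,6,7)], of c] assms
  by (auto simp: in_replicate_mset)

section \<open>Constraints on colourings with few colours\<close>

text \<open>Only two colours other than \<open>c\<close> remain, so each of the \<open>h\<close>
  disjoint edges joining \<open>2 * t\<close> and \<open>Suc (2 * t)\<close> carries both of them
  once.\<close>

lemma count_even_path_coloring:
  assumes "colorable_with (path_graph (2 * h)) P" "set_mset P \<subseteq> {..<3}" "c \<notin># P"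
    "c < 3" "i < 3" "i \<noteq> c"
  shows "count P i = h"
proof -
  obtain f where f: "\<And>u v. (u, v) \<in> parcs (path_graph (2 * h)) \<Longrightarrow> f u \<noteq> f v"
    "image_mset f (mset_set {..<2 * h}) = P"
    using assms(1) unfolding colorable_with_def by (auto simp: path_graph_def)
  have range: "f j < 3" "f j \<noteq> c" if "j < 2 * h" for j
    using assms(2,3) that unfolding f(2)[symmetric] by auto
  have "count (image_mset f (mset_set {..<2 * t})) i = t" if "t \<le> h" for t
    using that
  proof (induction t)
    case 0
    then show ?case by simp
  next
    case (Suc t)
    have "f (2 * t) \<noteq> f (Suc (2 * t))"
      using Suc.prems by (intro f(1)) (auto simp: path_graph_def)
    moreover have "f (2 * t) < 3" "f (2 * t) \<noteq> c" "f (Suc (2 * t)) < 3" "f (Suc (2 * t)) \<noteq> c"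
      using range Suc.prems by auto
    ultimately have "(f (2 * t) = i) \<noteq> (f (Suc (2 * t)) = i)"
      using assms(4-6) by linarith
    then show ?case
      using Suc by (auto simp: lessThan_Suc)
  qed
  then show ?thesis using f(2) by blast
qed

text \<open>A base vertex coloured \<open>i\<close> adds 1 to class \<open>i\<close> and every other
  one adds \<open>h\<close>; the equation is arranged to avoid subtraction on
  \<open>nat\<close>.\<close>

lemma corona_ext_even_path_count:
  assumes "corona_ext (path_graph (2 * h)) M M'" "set_mset M' \<subseteq> {..<3}"
  shows "set_mset M \<subseteq> {..<3} \<and>
    (\<forall>i<3. count M' i + h * count M i = count M i + h * size M)"
  using assms
proof induction
  case empty
  then show ?case by simp
next
  case (add A B P c)
  have "count P c = 0" using add.hyps(3) by (simp add: not_in_iff)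
  moreover have "count P i = h" if "i < 3" "i \<noteq> c" for i
    using count_even_path_coloring[OF add.hyps(2) _ add.hyps(3) _ that] add.prems by auto
  ultimately show ?case using add by (auto simp: algebra_simps)
qed

lemma three_coloring_spread:
  assumes "h \<ge> 3" "colorable_with (corona_power K1 (path_graph (2 * h)) l) M"
    "set_mset M \<subseteq> {..<3}"
  shows "\<exists>i<3. \<exists>j<3. count M j + 2 ^ l \<le> count M i"
  using assms(2,3)
proof (induction l arbitrary: M)
  case 0
  then obtain c where "M = {#c#}" using colorable_with_K1_power_0 by blast
  moreover from this have "c < 3" using 0 by auto
  \<comment> \<open>The single vertex has colour \<open>c\<close>; the second witness is any other
    colour below 3, whose class is empty.\<close>
  ultimately show ?case
    by (intro exI[of _ c] conjI exI[of _ "if c = 0 then 1 else 0"]) auto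
next
  case (Suc l)
  then obtain N where N: "colorable_with (corona_power K1 (path_graph (2 * h)) l) N"
    "corona_ext (path_graph (2 * h)) N M"
    using colorable_with_corona_power_Suc[OF pair_graph_K1 pair_graph_path_graph] by blast
  note cnt = corona_ext_even_path_count[OF N(2) Suc.prems(2)]
  from Suc.IH[OF N(1)] cnt obtain i j where
    ij: "i < 3" "j < 3" "count N j + 2 ^ l \<le> count N i" by blast
  \<comment> \<open>This makes the factor \<open>h - 1\<close> available as the natural number
    \<open>g + 2\<close>.\<close>
  obtain g where g: "h = g + 3" using assms(1) by (metis add.commute le_Suc_ex)
  have "count M i + (g + 2) * count N i = count M j + (g + 2) * count N j"
  proof -
    have "count M i + h * count N i = count N i + h * size N"
      "count M j + h * count N j = count N j + h * size N"
      using cnt ij(1,2) by blast+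
    then show ?thesis unfolding g by (simp add: algebra_simps)
  qed
  moreover have "(g + 2) * (count N j + 2 ^ l) \<le> (g + 2) * count N i"
    using ij(3) by (rule mult_le_mono2)
  moreover have "2 * 2 ^ l \<le> (g + 2) * 2 ^ l" by simp
  \<comment> \<open>The factor \<open>1 - h\<close> is negative, so \<open>i\<close> and
    \<open>j\<close> exchange roles at every level.\<close>
  ultimately have "count M i + 2 ^ Suc l \<le> count M j"
    unfolding power_Suc distrib_left by linarith
  then show ?case using ij(1,2) by blast
qed

lemma colorable_with_K1_power_nonempty:
  "colorable_with (corona_power K1 (path_graph m) l) M \<Longrightarrow> M \<noteq> {#}"
proof (induction l arbitrary: M)
  case 0
  then show ?case unfolding colorable_with_K1_power_0 by auto
next
  case (Suc l)
  then obtain N where N: "colorable_with (corona_power K1 (path_graph m) l) N"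
    "corona_ext (path_graph m) N M"
    using colorable_with_corona_power_Suc[OF pair_graph_K1 pair_graph_path_graph] by blast
  from N(2) Suc.IH[OF N(1)] show ?case by cases auto
qed

text \<open>A base vertex and the first edge of its path form a triangle.\<close>

lemma corona_ext_path_three_colors:
  assumes "corona_ext (path_graph m) M M'" "M \<noteq> {#}" "m \<ge> 2" "set_mset M' \<subseteq> {..<k}"
  shows "k \<ge> 3"
  using assms(1)
proof cases
  case empty
  then show ?thesis using assms(2) by simp
next
  case (add A B P c)
  obtain f where f: "\<And>u v. (u, v) \<in> parcs (path_graph m) \<Longrightarrow> f u \<noteq> f v"
    "image_mset f (mset_set {..<m}) = P"
    using add(4) unfolding colorable_with_def by (auto simp: path_graph_def)
  have "f 0 \<noteq> f 1" using assms(3) by (intro f(1)) (auto simp: path_graph_def)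
  moreover have P: "f 0 \<in># P" "f 1 \<in># P" using assms(3) unfolding f(2)[symmetric] by auto
  moreover have "c \<noteq> f 0" "c \<noteq> f 1" using P add(5) by auto
  ultimately have "card {c, f 0, f 1} = 3" by simp
  moreover have "card {c, f 0, f 1} \<le> card {..<k}"
    using assms(4) P unfolding add(2) by (intro card_mono) auto
  ultimately show ?thesis by simp
qed

section \<open>Extending balanced blocks and small surpluses by one corona\<close>

abbreviation colors4 :: "nat multiset" where "colors4 \<equiv> {#0, 1, 2, 3#}"
abbreviation colors3 :: "nat multiset" where "colors3 \<equiv> {#0, 1, 2#}"

lemma corona_ext_cong:
  "corona_ext H A A' \<Longrightarrow> A = B \<Longrightarrow> A' = B' \<Longrightarrow> corona_ext H B B'"
  by simp

text \<open>The path of a vertex coloured \<open>c\<close> alternates the next two colours in cyclic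
  order, the first on the larger half \<open>a\<close>. Over one block each colour then occurs once
  as \<open>c\<close>, \<open>a\<close> times and \<open>b\<close> times, which is
  \<open>m + 1\<close> in all.\<close>

lemma corona_ext_colors:
  assumes "colors \<in> {colors3, colors4}"
  shows "corona_ext (path_graph m) (repeat_mset n colors) (repeat_mset (n * (m + 1)) colors)"
proof -
  define a b where "a = (m + 1) div 2" and "b = m div 2"
  have m: "m + 1 = Suc (a + b)" by (auto simp: a_def b_def)
  have p: "corona_ext (path_graph m) {#c#} (add_mset c (replicate_mset a x + replicate_mset b y))"
    if "x \<noteq> y" "c \<noteq> x" "c \<noteq> y" for c x y
    using corona_ext_path[of x y y c a m b 0] that by (simp add: a_def b_def)
  have "corona_ext (path_graph m) colors3 (repeat_mset (m + 1) colors3)"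
    unfolding m
    by (rule corona_ext_cong[OF corona_ext_union[OF p[of 1 2 0]
          corona_ext_union[OF p[of 2 0 1] p[of 0 1 2]]]])
      (auto intro!: multiset_eqI)
  moreover have "corona_ext (path_graph m) colors4 (repeat_mset (m + 1) colors4)"
    unfolding m
    by (rule corona_ext_cong[OF corona_ext_union[OF p[of 1 2 0]
          corona_ext_union[OF p[of 2 3 1] corona_ext_union[OF p[of 3 0 2] p[of 0 1 3]]]]])
      (auto intro!: multiset_eqI)
  ultimately have "corona_ext (path_graph m) colors (repeat_mset (m + 1) colors)"
    using assms by blast
  from corona_ext_repeat[OF this, of n] show ?thesis
    by (simp only: repeat_mset_right mult.commute)
qed

text \<open>Sets the balanced blocks aside, so that each induction step has to deal only with a
  surplus \<open>A\<close>.\<close>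

lemma corona_ext_colors_plus:
  assumes "colors \<in> {colors3, colors4}"
    and "corona_ext (path_graph m) A (repeat_mset r colors + B)"
  shows "corona_ext (path_graph m) (repeat_mset n colors + A)
    (repeat_mset (n * (m + 1) + r) colors + B)"
  using corona_ext_union[OF corona_ext_colors[OF assms(1), of m n] assms(2)]
  by (simp add: left_add_mult_distrib_mset add.assoc)

text \<open>A lone vertex coloured 0 would leave colour 0 far behind. With a quadruple added, the
  paths of the vertices coloured 1, 2 and 3 use 0 exactly \<open>2 * s\<close>, \<open>2 * s\<close>
  and \<open>s\<close> times, and the surplus 0 is reproduced.\<close>

lemma corona_ext_4s:
  "corona_ext (path_graph (4 * s)) (colors4 + {#0#}) (repeat_mset (5 * s + 1) colors4 + {#0#})"
proof -
  have p: "corona_ext (path_graph (4 * s)) {#c#}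
      (add_mset c (replicate_mset (2 * s) x + replicate_mset k y + replicate_mset j z))"
    if "x \<noteq> y" "x \<noteq> z" "c \<noteq> x" "c \<noteq> y" "c \<noteq> z" "k + j = 2 * s" for c x y z k j
    using that by (intro corona_ext_path) auto
  show ?thesis
    by (rule corona_ext_cong[OF corona_ext_union[OF p[of 1 3 2 0 s s]
          corona_ext_union[OF p[of 3 1 2 0 s s] corona_ext_union[OF p[of 0 2 2 1 "2 * s" 0]
          corona_ext_union[OF p[of 0 3 3 2 "2 * s" 0] p[of 1 0 2 3 s s]]]]]])
      (auto intro!: multiset_eqI)
qed

text \<open>Here the order is \<open>5 * (4 * s + 3)\<close>, which is 3 modulo 4, so the surplus
  grows from one vertex to three; \<open>s - 1\<close> zeros on the last path put the deficit on
  colour 0. The hypothesis on \<open>s\<close> makes \<open>s - 1\<close> and \<open>s + 2\<close>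
  add up to \<open>2 * s + 1\<close>.\<close>

lemma corona_ext_4s_2_one:
  assumes "s \<ge> 1"
  shows "corona_ext (path_graph (4 * s + 2)) (colors4 + {#0#})
    (repeat_mset (5 * s + 3) colors4 + {#1, 2, 3#})"
proof -
  have p: "corona_ext (path_graph (4 * s + 2)) {#c#}
      (add_mset c (replicate_mset (2 * s + 1) x + replicate_mset k y + replicate_mset j z))"
    if "x \<noteq> y" "x \<noteq> z" "c \<noteq> x" "c \<noteq> y" "c \<noteq> z" "k + j = 2 * s + 1" for c x y z k j
    using that by (intro corona_ext_path) auto
  show ?thesis
    using assms
    by (intro corona_ext_cong[OF corona_ext_union[OF p[of 1 3 2 0 "s + 1" s]
          corona_ext_union[OF p[of 3 1 2 0 "s + 1" s]
          corona_ext_union[OF p[of 0 2 2 1 "2 * s + 1" 0]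
          corona_ext_union[OF p[of 0 3 3 2 "2 * s + 1" 0] p[of 1 0 2 3 "s - 1" "s + 2"]]]]]])
      (auto intro!: multiset_eqI)
qed

text \<open>Counterpart of \<open>corona_ext_4s_2_one\<close>: colour 0 is absent from the base and
  gets \<open>s + 1\<close> vertices on each of the three paths, one more in total than each other
  colour.\<close>

lemma corona_ext_4s_2_three:
  "corona_ext (path_graph (4 * s + 2)) {#1, 2, 3#} (repeat_mset (3 * s + 2) colors4 + {#0#})"
proof -
  have p: "corona_ext (path_graph (4 * s + 2)) {#c#}
      (add_mset c (replicate_mset (2 * s + 1) x + replicate_mset (s + 1) y + replicate_mset s z))"
    if "x \<noteq> y" "x \<noteq> z" "c \<noteq> x" "c \<noteq> y" "c \<noteq> z" for c x y z
    using that by (intro corona_ext_path) auto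
  show ?thesis
    by (rule corona_ext_cong[OF corona_ext_union[OF p[of 2 0 3 1]
          corona_ext_union[OF p[of 3 0 1 2] p[of 1 0 2 3]]]])
      (auto intro!: multiset_eqI)
qed

section \<open>Explicit colourings for \<open>l = 1\<close> and \<open>l = 2\<close>\<close>

lemma colorable_with_K1_power_SucI:
  "colorable_with (corona_power K1 (path_graph m) l) M \<Longrightarrow> corona_ext (path_graph m) M M' \<Longrightarrow>
    colorable_with (corona_power K1 (path_graph m) (Suc l)) M'"
  using colorable_with_corona_power_Suc[OF pair_graph_K1 pair_graph_path_graph] by blast

lemma colorable_with_K1_power_1:
  assumes "a = (m + 1) div 2" "b = m div 2"
  shows "colorable_with (corona_power K1 (path_graph m) 1)
    ({#0#} + replicate_mset a 1 + replicate_mset b 2)"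
proof -
  have "corona_ext (path_graph m) {#0#} ({#0#} + replicate_mset a 1 + replicate_mset b 2)"
    using corona_ext_path[of 1 2 2 0 a m b 0] assms by simp
  then show ?thesis
    unfolding One_nat_def
    by (rule colorable_with_K1_power_SucI[rotated]) (auto simp only: colorable_with_K1_power_0)
qed

lemma colorable_with_K1_power_2I:
  assumes "a = (m + 1) div 2" "b = m div 2"
    "corona_ext (path_graph m) ({#0#} + replicate_mset a 1 + replicate_mset b 2) M"
  shows "colorable_with (corona_power K1 (path_graph m) 2) M"
  using colorable_with_K1_power_SucI[OF colorable_with_K1_power_1[OF assms(1,2)] assms(3)]
  unfolding Suc_1 .

lemma corona_ext_replicate:
  assumes "corona_ext H {#c#} A"
  shows "corona_ext H (replicate_mset n c) (repeat_mset n A)"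
  using corona_ext_repeat[OF assms, of n] by simp

lemma colorable_with_K1_power_2_even:
  assumes "h \<ge> 1"
  shows "colorable_with (corona_power K1 (path_graph (2 * h)) 2)
    (repeat_mset (h * h + h) colors4 + {#0#})"
proof -
  obtain g where g: "h = Suc g" using assms by (cases h) auto
  have p: "corona_ext (path_graph (2 * h)) (replicate_mset n c)
      (repeat_mset n (add_mset c (replicate_mset h x + replicate_mset h y)))"
    if "x \<noteq> y" "c \<noteq> x" "c \<noteq> y" for c x y n
    using corona_ext_path[of x y y c h "2 * h" h 0] that by (intro corona_ext_replicate) auto
  have "corona_ext (path_graph (2 * h)) ({#0#} + replicate_mset h 1 + replicate_mset h 2)
      (repeat_mset (h * h + h) colors4 + {#0#})"
    \<comment> \<open>If all \<open>h\<close> vertices coloured 2 had paths in 1 and 3, colour 1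
      would exceed its share by \<open>h\<close>. One of these paths uses 0 instead of 1, which
      moves exactly \<open>h\<close> vertices to colour 0.\<close>
    by (rule corona_ext_cong[OF corona_ext_union[OF p[of 1 3 0 1]
          corona_ext_union[OF p[of 0 2 1 h] corona_ext_union[OF p[of 1 3 2 g] p[of 0 3 2 1]]]]])
      (auto intro!: multiset_eqI simp: g algebra_simps)
  then show ?thesis by (rule colorable_with_K1_power_2I[rotated 2]) simp_all
qed

lemma colorable_with_K1_power_2_odd:
  "colorable_with (corona_power K1 (path_graph (2 * h + 1)) 2)
    (repeat_mset ((h + 1) * (h + 1)) colors4)"
proof -
  have p: "corona_ext (path_graph (2 * h + 1)) (replicate_mset n c)
      (repeat_mset n (add_mset c (replicate_mset (h + 1) x + replicate_mset h y)))"
    if "x \<noteq> y" "c \<noteq> x" "c \<noteq> y" for c x y n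
    using corona_ext_path[of x y y c "h + 1" "2 * h + 1" h 0] that
    by (intro corona_ext_replicate) auto
  have "corona_ext (path_graph (2 * h + 1)) ({#0#} + replicate_mset (h + 1) 1 + replicate_mset h 2)
      (repeat_mset ((h + 1) * (h + 1)) colors4)"
    \<comment> \<open>The unequal halves \<open>h + 1\<close> and \<open>h\<close> are balanced by
      singling out one vertex coloured 1, whose path uses 3 and 0 instead of 0 and 2.\<close>
    by (rule corona_ext_cong[OF corona_ext_union[OF p[of 2 3 0 1]
          corona_ext_union[OF p[of 0 2 1 h] corona_ext_union[OF p[of 3 0 1 1] p[of 1 3 2 h]]]]])
      (auto intro!: multiset_eqI simp: algebra_simps)
  then show ?thesis by (rule colorable_with_K1_power_2I[rotated 2]) simp_all
qed

text \<open>For \<open>l = 1\<close> the path splits 3 to 2 beside a single root, giving sizes 1, 3,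
  2. At \<open>l = 2\<close> the choice of the larger half on each path evens this out to 12
  each.\<close>

lemma colorable_with_K1_power_2_five:
  "colorable_with (corona_power K1 (path_graph 5) 2) (repeat_mset 12 colors3)"
proof -
  have p: "corona_ext (path_graph 5) (replicate_mset n c)
      (repeat_mset n (add_mset c (replicate_mset 3 x + replicate_mset 2 y)))"
    if "x \<noteq> y" "c \<noteq> x" "c \<noteq> y" for c x y n
    using corona_ext_path[of x y y c 3 5 2 0] that by (intro corona_ext_replicate) auto
  have "corona_ext (path_graph 5) ({#0#} + replicate_mset 3 1 + replicate_mset 2 2)
      (repeat_mset 12 colors3)"
    by (rule corona_ext_cong[OF corona_ext_union[OF p[of 1 2 0 1]
          corona_ext_union[OF p[of 0 2 1 1] corona_ext_union[OF p[of 2 0 1 2] p[of 1 0 2 2]]]]])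
      (auto intro!: multiset_eqI)
  then show ?thesis by (rule colorable_with_K1_power_2I[rotated 2]) simp_all
qed

section \<open>Four colours at every level\<close>

text \<open>For even \<open>h\<close> the surplus stays one vertex coloured 0; for odd
  \<open>h\<close> it alternates between that and one vertex of each other colour. The bound on
  \<open>n\<close> guarantees a quadruple to treat together with a single surplus vertex.\<close>

lemma colorable_with_K1_power_even:
  assumes "h \<ge> 2" "l \<ge> 2"
  shows "\<exists>n\<ge>1. \<exists>B. (B = {#0#} \<or> odd h \<and> B = {#1, 2, 3#}) \<and>
    colorable_with (corona_power K1 (path_graph (2 * h)) l) (repeat_mset n colors4 + B)"
  using assms(2)
proof (induction l rule: dec_induct)
  case base
  have "h * h + h \<ge> 1" using assms(1) by simp
  then show ?case using colorable_with_K1_power_2_even[of h] assms(1)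
    by (intro exI[of _ "h * h + h"] exI[of _ "{#0#}"] conjI disjI1 refl) simp_all
next
  case (step l)
  then obtain n B where n: "n \<ge> 1" and B: "B = {#0#} \<or> odd h \<and> B = {#1, 2, 3#}"
    and col: "colorable_with (corona_power K1 (path_graph (2 * h)) l) (repeat_mset n colors4 + B)"
    by blast
  obtain n' where n': "n = Suc n'" using n by (cases n) auto
  \<comment> \<open>Used when the surplus is a single vertex; a surplus of three is extended without
    a quadruple.\<close>
  have split: "repeat_mset n colors4 + B = repeat_mset n' colors4 + (colors4 + B)"
    by (simp add: n')
  consider (even) s where "h = 2 * s" "B = {#0#}" | (one) s where "h = 2 * s + 1" "B = {#0#}"
    | (three) s where "h = 2 * s + 1" "B = {#1, 2, 3#}"
    using B by (cases "even h") (auto elim!: evenE oddE)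
  then obtain r B' where "r \<ge> 1" "B' = {#0#} \<or> odd h \<and> B' = {#1, 2, 3#}"
    "corona_ext (path_graph (2 * h)) (repeat_mset n colors4 + B) (repeat_mset r colors4 + B')"
  proof cases
    case (even s)
    then have h: "2 * h = 4 * s" by simp
    have "corona_ext (path_graph (2 * h)) (repeat_mset n colors4 + B)
        (repeat_mset (n' * (4 * s + 1) + (5 * s + 1)) colors4 + {#0#})"
      unfolding split unfolding even(2) h by (rule corona_ext_colors_plus[OF _ corona_ext_4s]) blast
    from that[OF _ _ this] show ?thesis by simp
  next
    case (one s)
    then have h: "2 * h = 4 * s + 2" and s: "s \<ge> 1" and "odd h" using assms(1) by auto
    have "corona_ext (path_graph (2 * h)) (repeat_mset n colors4 + B)
        (repeat_mset (n' * (4 * s + 2 + 1) + (5 * s + 3)) colors4 + {#1, 2, 3#})"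
      unfolding split unfolding one(2) h
      by (rule corona_ext_colors_plus[OF _ corona_ext_4s_2_one[OF s]]) blast
    from that[OF _ _ this] \<open>odd h\<close> show ?thesis by simp
  next
    case (three s)
    then have h: "2 * h = 4 * s + 2" by simp
    have "corona_ext (path_graph (2 * h)) (repeat_mset n colors4 + B)
        (repeat_mset (n * (4 * s + 2 + 1) + (3 * s + 2)) colors4 + {#0#})"
      unfolding three(2) h
      by (rule corona_ext_colors_plus[OF _ corona_ext_4s_2_three]) blast
    from that[OF _ _ this] show ?thesis by simp
  qed
  then show ?case
    using colorable_with_K1_power_SucI[OF col] by blast
qed

lemma colorable_with_K1_power_balanced:
  assumes "colors \<in> {colors3, colors4}" "k \<le> l"
    "colorable_with (corona_power K1 (path_graph m) k) (repeat_mset n colors)"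
  shows "\<exists>n. colorable_with (corona_power K1 (path_graph m) l) (repeat_mset n colors)"
  using assms(2)
proof (induction l rule: dec_induct)
  case base
  then show ?case using assms(3) by blast
next
  case (step l)
  then show ?case
    using colorable_with_K1_power_SucI corona_ext_colors[OF assms(1)] by blast
qed

lemma equitably_colorable_4:
  assumes "m \<ge> 3" "l \<ge> 2"
  shows "equitably_colorable (corona_power K1 (path_graph m) l) 4"
proof -
  let ?G = "corona_power K1 (path_graph m) l"
  have "\<exists>n B. B \<in> {{#}, {#0#}, {#1, 2, 3#}} \<and> colorable_with ?G (repeat_mset n colors4 + B)"
  proof (cases "even m")
    case True
    then obtain h where "m = 2 * h" by blast
    then show ?thesis using colorable_with_K1_power_even[of h l] assms by fastforce
  next
    case False
    then obtain h where "m = 2 * h + 1" by (blast elim: oddE)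
    then obtain n where "colorable_with ?G (repeat_mset n colors4)"
      using colorable_with_K1_power_balanced[OF _ assms(2) colorable_with_K1_power_2_odd[of h]]
      by auto
    then show ?thesis by (intro exI[of _ n] exI[of _ "{#}"]) simp
  qed
  then obtain n B where B: "B \<in> {{#}, {#0#}, {#1, 2, 3#}}"
    "colorable_with ?G (repeat_mset n colors4 + B)" by blast
  have lt: "i < 4 \<longleftrightarrow> i = 0 \<or> i = 1 \<or> i = 2 \<or> i = 3" for i :: nat by auto
  show ?thesis
    unfolding equitably_colorable_iff[OF pair_graph_corona_power[OF pair_graph_K1 pair_graph_path_graph]]
    by (rule exI[of _ "repeat_mset n colors4 + B"]) (use B in \<open>auto simp: lt split: if_splits\<close>)
qed

section \<open>Three colours for paths on two to five vertices\<close>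

text \<open>The first corona is a triangle and hence already balanced.\<close>

lemma colorable_with_K1_power_two:
  assumes "l \<ge> 1"
  shows "\<exists>n. colorable_with (corona_power K1 (path_graph 2) l) (repeat_mset n colors3)"
proof (rule colorable_with_K1_power_balanced[OF _ assms, of _ _ 1])
  show "colorable_with (corona_power K1 (path_graph 2) 1) (repeat_mset 1 colors3)"
    using colorable_with_K1_power_1[of 1 2 1] by (simp add: add_mset_commute)
qed auto

text \<open>The path of the surplus vertex takes the cyclically next colour twice and the remaining
  one once, so the surplus moves on by one colour modulo 3.\<close>

lemma colorable_with_K1_power_three:
  "\<exists>n. \<exists>a<3. colorable_with (corona_power K1 (path_graph 3) l) (repeat_mset n colors3 + {#a#})"
proof (induction l)
  case 0
  then show ?case
    by (intro exI[of _ 0]) (auto simp only: colorable_with_K1_power_0 repeat_mset_0 add_0)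
next
  case (Suc l)
  then obtain n a where a: "a < 3"
    "colorable_with (corona_power K1 (path_graph 3) l) (repeat_mset n colors3 + {#a#})" by blast
  define b c where "b = (a + 1) mod 3" and "c = (a + 2) mod 3"
  have lt: "i < 3 \<longleftrightarrow> i = 0 \<or> i = 1 \<or> i = 2" for i :: nat by auto
  have bc: "b < 3" "b \<noteq> c" "a \<noteq> b" "a \<noteq> c" and cols: "colors3 = {#a, b, c#}"
    using a(1) unfolding lt by (auto simp: b_def c_def)
  have "corona_ext (path_graph 3) {#a#} (repeat_mset 1 colors3 + {#b#})"
    unfolding cols
    by (rule corona_ext_cong[OF corona_ext_path[of b c c a 2 3 1 0]])
      (use bc in \<open>auto intro!: multiset_eqI\<close>)
  from corona_ext_colors_plus[OF _ this, of n] show ?case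
    using colorable_with_K1_power_SucI[OF a(2)] bc(1) by blast
qed

text \<open>This is \<open>h = 2\<close>, where the factor \<open>1 - h\<close> is -1: differences
  only change sign, and a surplus of colour 0 alternates with a deficit of it.\<close>

lemma colorable_with_K1_power_four:
  "\<exists>n. \<exists>B\<in>{{#0#}, {#1, 2#}}.
    colorable_with (corona_power K1 (path_graph 4) l) (repeat_mset n colors3 + B)"
proof (induction l)
  case 0
  then show ?case
    by (intro exI[of _ 0]) (auto simp only: colorable_with_K1_power_0 repeat_mset_0 add_0)
next
  case (Suc l)
  then obtain n B where B: "B \<in> {{#0#}, {#1, 2#}}"
    "colorable_with (corona_power K1 (path_graph 4) l) (repeat_mset n colors3 + B)" by blast
  have p: "corona_ext (path_graph 4) {#c#} (add_mset c (replicate_mset 2 x + replicate_mset 2 y))"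
    if "x \<noteq> y" "c \<noteq> x" "c \<noteq> y" for c x y
    using corona_ext_path[of x y y c 2 4 2 0] that by simp
  have "corona_ext (path_graph 4) {#0#} (repeat_mset 1 colors3 + {#1, 2#})"
    by (rule corona_ext_cong[OF p[of 1 2 0]]) (auto intro!: multiset_eqI)
  moreover have "corona_ext (path_graph 4) {#1, 2#} (repeat_mset 3 colors3 + {#0#})"
    by (rule corona_ext_cong[OF corona_ext_union[OF p[of 0 2 1] p[of 0 1 2]]])
      (auto intro!: multiset_eqI)
  ultimately have "\<exists>r. \<exists>B'\<in>{{#0#}, {#1, 2#}}. corona_ext (path_graph 4) B (repeat_mset r colors3 + B')"
    using B(1) by blast
  then show ?case
    using colorable_with_K1_power_SucI[OF B(2)] corona_ext_colors_plus[of colors3 4 B _ _ n] by blast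
qed

lemma equitably_colorable_3:
  assumes "m \<in> {2, 3, 4, 5}" "l \<ge> 2"
  shows "equitably_colorable (corona_power K1 (path_graph m) l) 3"
proof -
  let ?G = "corona_power K1 (path_graph m) l"
  have lt: "i < 3 \<longleftrightarrow> i = 0 \<or> i = 1 \<or> i = 2" for i :: nat by auto
  consider "m = 2" | "m = 3" | "m = 4" | "m = 5" using assms(1) by blast
  then have "\<exists>n B. B \<in> {{#}, {#0#}, {#1#}, {#2#}, {#1, 2#}} \<and>
      colorable_with ?G (repeat_mset n colors3 + B)"
  proof cases
    case 1
    then obtain n where "colorable_with ?G (repeat_mset n colors3)"
      using colorable_with_K1_power_two[of l] assms by auto
    then show ?thesis by (intro exI[of _ n] exI[of _ "{#}"]) simp
  next
    case 2
    then show ?thesis using colorable_with_K1_power_three[of l] unfolding lt by blast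
  next
    case 3
    then show ?thesis using colorable_with_K1_power_four[of l] by blast
  next
    case 4
    then obtain n where "colorable_with ?G (repeat_mset n colors3)"
      using colorable_with_K1_power_balanced[OF _ assms(2) colorable_with_K1_power_2_five] by auto
    then show ?thesis by (intro exI[of _ n] exI[of _ "{#}"]) simp
  qed
  then obtain n B where B: "B \<in> {{#}, {#0#}, {#1#}, {#2#}, {#1, 2#}}"
    "colorable_with ?G (repeat_mset n colors3 + B)" by blast
  show ?thesis
    unfolding equitably_colorable_iff[OF pair_graph_corona_power[OF pair_graph_K1 pair_graph_path_graph]]
    by (rule exI[of _ "repeat_mset n colors3 + B"]) (use B in \<open>auto simp: lt split: if_splits\<close>)
qed

section \<open>Excluded numbers of colours and the resulting values\<close>

lemma equitably_colorable_ge_3: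
  assumes "m \<ge> 2" "l \<ge> 1" "equitably_colorable (corona_power K1 (path_graph m) l) k"
  shows "k \<ge> 3"
proof -
  obtain l' where l: "l = Suc l'" using assms(2) by (cases l) auto
  obtain M where "colorable_with (corona_power K1 (path_graph m) (Suc l')) M" "set_mset M \<subseteq> {..<k}"
    using assms(3) l
      equitably_colorable_iff[OF pair_graph_corona_power[OF pair_graph_K1 pair_graph_path_graph]]
    by blast
  then show ?thesis
    using colorable_with_corona_power_Suc[OF pair_graph_K1 pair_graph_path_graph]
      corona_ext_path_three_colors[OF _ colorable_with_K1_power_nonempty assms(1)] by metis
qed

lemma not_equitably_colorable_3:
  assumes "m \<ge> 6" "even m" "l \<ge> 1"
  shows "\<not> equitably_colorable (corona_power K1 (path_graph m) l) 3"
proof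
  assume "equitably_colorable (corona_power K1 (path_graph m) l) 3"
  then obtain M where M: "colorable_with (corona_power K1 (path_graph m) l) M"
    "set_mset M \<subseteq> {..<3}" "\<forall>i<3. \<forall>j<3. \<bar>int (count M i) - int (count M j)\<bar> \<le> 1"
    using equitably_colorable_iff[OF pair_graph_corona_power[OF pair_graph_K1 pair_graph_path_graph]]
    by blast
  obtain h where h: "m = 2 * h" "h \<ge> 3" using assms(1,2) by auto
  obtain i j where ij: "i < 3" "j < 3" "count M j + 2 ^ l \<le> count M i"
    using three_coloring_spread[OF h(2) M(1)[unfolded h(1)] M(2)] by blast
  \<comment> \<open>A single corona already forces a gap of at least 2.\<close>
  have "(2::nat) ^ 1 \<le> 2 ^ l" using assms(3) by (intro power_increasing) auto
  moreover have "\<bar>int (count M i) - int (count M j)\<bar> \<le> 1" using M(3) ij by blast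
  ultimately show False using ij(3) by auto
qed

theorem theorem8:
  fixes m l :: nat
  assumes "m \<ge> 2" and "l \<ge> 2"
  shows "(m \<in> {2, 3, 4, 5} \<longrightarrow> \<chi>\<^sub>= (corona_power K1 (path_graph m) l) = 3) \<and>
         (m \<ge> 6 \<and> even m \<longrightarrow> \<chi>\<^sub>= (corona_power K1 (path_graph m) l) = 4) \<and>
         (\<not> m \<in> {2, 3, 4, 5} \<and> \<not> (m \<ge> 6 \<and> even m) \<longrightarrow>
            \<chi>\<^sub>= (corona_power K1 (path_graph m) l) \<le> 4)"
proof (intro conjI impI)
  have ge3: "k \<ge> 3" if "equitably_colorable (corona_power K1 (path_graph m) l) k" for k
    using equitably_colorable_ge_3[of m l k] assms that by auto
  show "\<chi>\<^sub>= (corona_power K1 (path_graph m) l) = 3" if "m \<in> {2, 3, 4, 5}"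
    unfolding equitable_chromatic_number_def
    using equitably_colorable_3[OF that assms(2)] ge3 by (rule Least_equality)
  show "\<chi>\<^sub>= (corona_power K1 (path_graph m) l) = 4" if "m \<ge> 6 \<and> even m"
    unfolding equitable_chromatic_number_def
  proof (rule Least_equality)
    show "equitably_colorable (corona_power K1 (path_graph m) l) 4"
      using equitably_colorable_4 that assms(2) by simp
    fix k assume k: "equitably_colorable (corona_power K1 (path_graph m) l) k"
    have "k \<noteq> 3" using k not_equitably_colorable_3[of m l] that assms(2) by auto
    then show "4 \<le> k" using ge3[OF k] by simp
  qed
  \<comment> \<open>What remains is odd \<open>m\<close> from 7 on, where only the upper bound is
    claimed.\<close>
  show "\<chi>\<^sub>= (corona_power K1 (path_graph m) l) \<le> 4"
    if "\<not> m \<in> {2, 3, 4, 5} \<and> \<not> (m \<ge> 6 \<and> even m)"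
    unfolding equitable_chromatic_number_def
    using that assms by (intro Least_le equitably_colorable_4) auto
qed

end
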